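(* Let $K$ be a twisted knot, let $\#b(K)$ be the number of bars on a diagram of $K$, let $J(K)$ be its odd writhe and $\tilde F(K)$ its forbidden number. Then $$\tilde F(K)\ge \frac{J(K)}{4}\quad\text{when } \#b(K)\text{ is even},$$ and $$\tilde F(K)\ge \frac{J(K)}{2}\quad\text{when } \#b(K)\text{ is odd}.$$
   Context: **Twisted knots.** A twisted knot diagram is a generic closed oriented curve in $\mathbb{R}^2$ whose double points are each marked either as a classical crossing (with over/under information, hence a sign $\pm1$) or as a virtual crossing, and which carries finitely many bars (short transverse marks) placed on the curve away from the double points. Its Gauss diagram is an oriented circle parametrizing the curve, with one chord for each classical crossing joining its two preimages, directed from the over endpoint to the under endpoint and labelled with the sign, and with the bars recorded as marked points on the circle; virtual crossings are not recorded. Two diagrams represent the same twisted knot iff their Gauss diagrams are related by finitely many moves $R_1,R_2,R_3$ (the usual Reidemeister moves, with no bars between the endpoints required to be adjacent), $T_2$ (creation or deletion of two adjacent bars) and $T_3$ (a chord has its direction reversed, its sign kept, and one bar is added on each of the four circle segments adjacent to its two endpoints, or the inverse). A trivial twisted knot is the classical unknot (crossingless circle) with no bar or with one bar. The parity of the number of bars $\#b(K)$ depends only on $K$. **Odd writhe.** A classical crossing $c$ of a diagram $D$ is odd if the number of classical crossings met (with multiplicity) while traversing the diagram from $c$ until the first return to $c$ is odd; equivalently, an odd number of chord endpoints lies on either of the two circle segments cut off by the chord $c$. The odd writhe is $J(D)=\sum_{c\text{ odd}}\mathrm{sgn}(c)$; it is a known invariant of the twisted knot, written $J(K)$. **Forbidden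 moves and forbidden number.** On Gauss diagrams: $F_1$ (resp. $F_2$) interchanges two neighbouring over (resp. under) endpoints of two different chords, with no bar between them; $F_3$ (resp. $F_4$) interchanges two neighbouring over (resp. under) endpoints of two different chords having exactly one bar between them, the bar staying between them; in all of these, signs and directions of chords are unchanged. $T_4$ deletes a chord whose two endpoints are neighbouring except for exactly one bar between them, leaving the bar (or the inverse). The forbidden number $\tilde F(K)$ is the minimum number of forbidden moves ($F_1$ (or $F_2$), $F_3$ (or $F_4$), $T_4$) needed, together with any number of equivalence moves, to transform a diagram of $K$ into a diagram of a trivial twisted knot (finite by a known theorem of Xue and Deng). *)

theory Defs
  imports "HOL-Library.Extended_Real"
begin

section \<open>Gauss diagrams of twisted knots\<close>

text \<open>A Gauss diagram is encoded by the word read along the oriented circle from an arbitrary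
  base point. The sign is part of a chord, so both endpoints automatically carry the same sign.
  Virtual crossings leave no trace in a Gauss diagram, and every such word is the Gauss diagram
  of some twisted knot diagram.\<close>

datatype chord = Chord (chord_name: nat) (positive: bool)

definition chord_sign :: "chord \<Rightarrow> int" where
  "chord_sign c = (if positive c then 1 else -1)"

datatype mark = Bar | Over chord | Under chord

primrec relabel :: "(chord \<Rightarrow> chord) \<Rightarrow> mark \<Rightarrow> mark" where
  "relabel f Bar = Bar"
| "relabel f (Over c) = Over (f c)"
| "relabel f (Under c) = Under (f c)"

definition chords :: "mark list \<Rightarrow> chord set" where
  "chords w = {c. Over c \<in> set w \<or> Under c \<in> set w}"

definition endpoints :: "mark list \<Rightarrow> mark list" where
  "endpoints w = filter (\<lambda>m. m \<noteq> Bar) w"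

definition bars :: "mark list \<Rightarrow> nat" where
  "bars w = length (filter (\<lambda>m. m = Bar) w)"

text \<open>Every chord of the diagram has exactly one over and exactly one under endpoint.\<close>

definition gauss_diagram :: "mark list \<Rightarrow> bool" where
  "gauss_diagram w \<longleftrightarrow> distinct (endpoints w) \<and> (\<forall>c. Over c \<in> set w \<longleftrightarrow> Under c \<in> set w)"


section \<open>Equivalence moves\<close>

definition strand :: "int \<Rightarrow> mark \<Rightarrow> mark \<Rightarrow> mark list" where
  "strand k x y = (if k > 0 then [x, y] else [y, x])"

text \<open>The rules rotate and relabel express that the base point and the names of the chords are
  irrelevant; because of rotate, each remaining move may be stated with its first affected
  endpoint or bar at the head of the word. All moves are used below only between words satisfying
  gauss_diagram, which forces a created chord to be new and the chords named a, b, c in a move to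
  be distinct.

  In the third Reidemeister move, chord a joins the top to the middle strand, b the top to the
  bottom strand, and c the middle to the bottom strand. If d1, d2, d3 are the directions
  of these strands in the plane, then the signs of a, b, c are those of the determinants
  det(d1,d2), det(d1,d3), det(d2,d3). Solving for the intersection points of the three lines shows
  that a precedes b on the top strand iff e * sign a * sign b = 1, a precedes c on the middle
  strand iff e * sign a * sign c = 1, and b precedes c on the bottom strand iff
  e * sign b * sign c = 1, where e is 1 on one side of the move and -1 on the other; all eight
  sign triples are realised. The two rules R3a and R3b are the two cyclic orders in which the
  three strands may be traversed.\<close>

inductive equivalence_move :: "mark list \<Rightarrow> mark list \<Rightarrow> bool" where
  rotate: "equivalence_move (x # w) (w @ [x])"
| relabel: "equivalence_move w (map (relabel f) w)"
    if "inj_on f (chords w)" "\<forall>c\<in>chords w. chord_sign (f c) = chord_sign c"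
| R1a: "equivalence_move ([Over c, Under c] @ w) w"
| R1b: "equivalence_move ([Under c, Over c] @ w) w"
| R2a: "equivalence_move ([Over a, Over b] @ u @ [Under a, Under b] @ v) (u @ v)"
    if "chord_sign b = - chord_sign a"
| R2b: "equivalence_move ([Over a, Over b] @ u @ [Under b, Under a] @ v) (u @ v)"
    if "chord_sign b = - chord_sign a"
| R3a: "equivalence_move
      (strand (e * chord_sign a * chord_sign b) (Over a) (Over b) @ u @
       strand (e * chord_sign a * chord_sign c) (Under a) (Over c) @ v @
       strand (e * chord_sign b * chord_sign c) (Under b) (Under c) @ w)
      (strand (- e * chord_sign a * chord_sign b) (Over a) (Over b) @ u @
       strand (- e * chord_sign a * chord_sign c) (Under a) (Over c) @ v @
       strand (- e * chord_sign b * chord_sign c) (Under b) (Under c) @ w)"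
    if "e = 1 \<or> e = -1"
| R3b: "equivalence_move
      (strand (e * chord_sign a * chord_sign b) (Over a) (Over b) @ u @
       strand (e * chord_sign b * chord_sign c) (Under b) (Under c) @ v @
       strand (e * chord_sign a * chord_sign c) (Under a) (Over c) @ w)
      (strand (- e * chord_sign a * chord_sign b) (Over a) (Over b) @ u @
       strand (- e * chord_sign b * chord_sign c) (Under b) (Under c) @ v @
       strand (- e * chord_sign a * chord_sign c) (Under a) (Over c) @ w)"
    if "e = 1 \<or> e = -1"
| T2: "equivalence_move ([Bar, Bar] @ w) w"
| T3: "equivalence_move ([Over c] @ u @ [Under c] @ v)
      ([Bar, Under c, Bar] @ u @ [Bar, Over c, Bar] @ v)"

definition between_diagrams :: "(mark list \<Rightarrow> mark list \<Rightarrow> bool) \<Rightarrow> mark list rel" where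
  "between_diagrams move =
     {(D, D'). gauss_diagram D \<and> gauss_diagram D' \<and> (move D D' \<or> move D' D)}"

definition twisted_equivalence :: "mark list rel" where
  "twisted_equivalence =
     {(D, D'). gauss_diagram D \<and> gauss_diagram D' \<and>
               (D, D') \<in> (between_diagrams equivalence_move)\<^sup>*}"

lemma equiv_twisted_equivalence: "equiv (Collect gauss_diagram) twisted_equivalence"
proof -
  have "sym ((between_diagrams equivalence_move)\<^sup>*)"
    by (rule sym_rtrancl) (auto simp: sym_def between_diagrams_def)
  then show ?thesis
    unfolding twisted_equivalence_def
    by (auto intro!: equivI simp: refl_on_def sym_def trans_def)
qed

definition twisted_knots :: "mark list set set" where
  "twisted_knots = Collect gauss_diagram // twisted_equivalence"

definition trivial_twisted_knots :: "mark list set set" where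
  "trivial_twisted_knots = {twisted_equivalence `` {[]}, twisted_equivalence `` {[Bar]}}"


section \<open>The odd writhe\<close>

text \<open>The word y below is one of the two circle segments cut off by the chord c. The number of
  endpoints in a Gauss diagram is even, so the other segment gives the same parity.\<close>

definition odd_chord :: "mark list \<Rightarrow> chord \<Rightarrow> bool" where
  "odd_chord D c \<longleftrightarrow>
     (\<exists>x y z p q. D = x @ [p] @ y @ [q] @ z \<and> {p, q} = {Over c, Under c} \<and>
        odd (length (endpoints y)))"

definition odd_writhe :: "mark list \<Rightarrow> int" where
  "odd_writhe D = (\<Sum>c | c \<in> chords D \<and> odd_chord D c. chord_sign c)"


section \<open>Forbidden moves and the forbidden number\<close>

inductive forbidden_move :: "mark list \<Rightarrow> mark list \<Rightarrow> bool" where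
  F1: "forbidden_move ([Over a, Over b] @ w) ([Over b, Over a] @ w)"
| F2: "forbidden_move ([Under a, Under b] @ w) ([Under b, Under a] @ w)"
| F3: "forbidden_move ([Over a, Bar, Over b] @ w) ([Over b, Bar, Over a] @ w)"
| F4: "forbidden_move ([Under a, Bar, Under b] @ w) ([Under b, Bar, Under a] @ w)"
| T4a: "forbidden_move ([Over c, Bar, Under c] @ w) ([Bar] @ w)"
| T4b: "forbidden_move ([Under c, Bar, Over c] @ w) ([Bar] @ w)"

definition trivialized_by :: "nat \<Rightarrow> mark list \<Rightarrow> bool" where
  "trivialized_by n D \<longleftrightarrow>
     (\<exists>T \<in> \<Union> trivial_twisted_knots.
        (D, T) \<in> (twisted_equivalence O between_diagrams forbidden_move) ^^ n
                 O twisted_equivalence)"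

text \<open>A minimum of natural numbers, with the convention that it is infinite if no sequence of
  moves trivializes the knot.\<close>

definition forbidden_number :: "mark list set \<Rightarrow> enat" where
  "forbidden_number K = Inf {enat n | n. \<exists>D\<in>K. trivialized_by n D}"

end

theory Submission
  imports Defs
begin

text \<open>
  Why the theorem holds: the odd writhe is invariant under equivalence, vanishes on trivial
  knots, and a forbidden move changes it by at most \<open>2\<close>. Hence a knot that becomes trivial after
  \<open>n\<close> forbidden moves has \<open>\<bar>J\<bar> \<le> 2 * n\<close>. Both \<open>J / 2\<close> and \<open>J / 4\<close> are at most
  \<open>\<bar>J\<bar> / 2\<close>, so both bounds follow.

  Bars do not enter the definition of the odd writhe, so everything is computed on words without
  bars. Colour the endpoints alternately along such a word. A chord is odd iff its two endpoints
  have the same colour (lemma \<open>odd_chord_iff_monochromatic\<close>), because the number of endpoints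
  strictly between them is one less than the difference of their positions. All moves have simple
  effects on this colouring:

  \<^item> Exchanging two neighbouring endpoints switches exactly their two colours (lemma
    \<open>colour_swap\<close>). A third Reidemeister move makes three such exchanges and involves each of the
    three chords at both of its endpoints, so no chord changes its parity. The exchanges
    \<open>F\<^sub>1\<close>, \<open>F\<^sub>2\<close>, \<open>F\<^sub>3\<close>, \<open>F\<^sub>4\<close> involve two chords at one endpoint each, so only these two
    contributions to the odd writhe can change, each by at most \<open>1\<close>.
  \<^item> Moving the base point past one endpoint switches every colour, since the number of endpoints
    is even.
  \<^item> Deleting two neighbouring endpoints does not affect the other colours. In a first
    Reidemeister move, and after erasing the bar also in \<open>T\<^sub>4\<close>, the deleted chord is even. In a
    second Reidemeister move the deleted chords have equal parity and opposite signs.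
  \<^item> Without its bars, \<open>T\<^sub>3\<close> only exchanges the two endpoints of one chord.
\<close>

section \<open>Alternating colours and the odd writhe\<close>

definition colour :: "mark list \<Rightarrow> mark \<Rightarrow> bool" where
  "colour w m \<longleftrightarrow> odd (length (takeWhile (\<lambda>x. x \<noteq> m) w))"

definition monochromatic :: "mark list \<Rightarrow> chord \<Rightarrow> bool" where
  "monochromatic w c \<longleftrightarrow> (colour w (Over c) \<longleftrightarrow> colour w (Under c))"

definition monochromatic_writhe :: "mark list \<Rightarrow> int" where
  "monochromatic_writhe w =
     (\<Sum>c\<in>chords w. if monochromatic w c then chord_sign c else 0)"

lemma endpoints_simps [simp]:
  "endpoints [] = []"
  "endpoints (Bar # w) = endpoints w"
  "endpoints (Over c # w) = Over c # endpoints w"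
  "endpoints (Under c # w) = Under c # endpoints w"
  "endpoints (v @ w) = endpoints v @ endpoints w"
  by (simp_all add: endpoints_def)

lemma endpoint_in_endpoints [simp]:
  "Over c \<in> set (endpoints w) \<longleftrightarrow> Over c \<in> set w"
  "Under c \<in> set (endpoints w) \<longleftrightarrow> Under c \<in> set w"
  by (auto simp: endpoints_def)

lemma Bar_notin_endpoints [simp]: "Bar \<notin> set (endpoints w)"
  by (simp add: endpoints_def)

lemma endpoints_idem [simp]: "endpoints (endpoints w) = endpoints w"
  by (simp add: endpoints_def)

lemma endpoints_strand [simp]:
  "x \<noteq> Bar \<Longrightarrow> y \<noteq> Bar \<Longrightarrow> endpoints (strand k x y) = strand k x y"
  by (simp add: strand_def endpoints_def)

lemma endpoints_map_relabel: "endpoints (map (relabel f) w) = map (relabel f) (endpoints w)"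
proof (induction w)
  case (Cons m w)
  then show ?case by (cases m) auto
qed simp

lemma chords_endpoints [simp]: "chords (endpoints w) = chords w"
  by (simp add: chords_def)

lemma gauss_diagram_endpoints [simp]: "gauss_diagram (endpoints w) \<longleftrightarrow> gauss_diagram w"
  by (simp add: gauss_diagram_def)

lemma finite_chords [simp]: "finite (chords w)"
proof -
  have "chords w = Over -` set w \<union> Under -` set w"
    by (auto simp: chords_def)
  then show ?thesis by (simp add: finite_vimageI inj_on_def)
qed

lemma chords_simps [simp]:
  "chords [] = {}"
  "chords (Bar # w) = chords w"
  "chords (Over c # w) = insert c (chords w)"
  "chords (Under c # w) = insert c (chords w)"
  "chords (v @ w) = chords v \<union> chords w"
  by (auto simp: chords_def)

lemma colour_simps:
  "colour [] m \<longleftrightarrow> False"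
  "colour (x # w) m \<longleftrightarrow> x \<noteq> m \<and> \<not> colour w m"
  by (simp_all add: colour_def)

lemma colour_append:
  "colour (v @ w) m \<longleftrightarrow>
     (if m \<in> set v then colour v m else odd (length v) \<noteq> colour w m)"
  by (auto simp: colour_def takeWhile_append)

lemma odd_chord_iff_monochromatic:
  assumes "gauss_diagram D" "c \<in> chords D"
  shows "odd_chord D c \<longleftrightarrow> monochromatic (endpoints D) c"
proof -
  have dist: "distinct (endpoints D)" using assms by (simp add: gauss_diagram_def)
  have between: "odd (length (endpoints y)) \<longleftrightarrow> monochromatic (endpoints D) c"
    if D: "D = x @ [p] @ y @ [q] @ z" and pq: "{p, q} = {Over c, Under c}" for x y z p q
    using pq dist
    by (auto simp: D doubleton_eq_iff monochromatic_def colour_append colour_simps)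
  have "\<exists>x y z p q. D = x @ [p] @ y @ [q] @ z \<and> {p, q} = {Over c, Under c}"
  proof -
    have O: "Over c \<in> set D" and U: "Under c \<in> set D"
      using assms by (auto simp: chords_def gauss_diagram_def)
    obtain x z where D: "D = x @ Over c # z" using split_list[OF O] by blast
    with U consider "Under c \<in> set x" | "Under c \<in> set z" by auto
    then show ?thesis
    proof cases
      case 1
      then obtain x' y where "x = x' @ Under c # y" by (meson split_list)
      with D have "D = x' @ [Under c] @ y @ [Over c] @ z" by simp
      then show ?thesis by blast
    next
      case 2
      then obtain y z' where "z = y @ Under c # z'" by (meson split_list)
      with D have "D = x @ [Over c] @ y @ [Under c] @ z'" by simp
      then show ?thesis by blast
    qed
  qed
  then show ?thesis using between unfolding odd_chord_def by blast
qed

lemma odd_writhe_eq_monochromatic_writhe: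
  assumes "gauss_diagram D"
  shows "odd_writhe D = monochromatic_writhe (endpoints D)"
proof -
  have "{c. c \<in> chords D \<and> odd_chord D c}
      = {c \<in> chords D. monochromatic (endpoints D) c}"
    using odd_chord_iff_monochromatic[OF assms] by blast
  then have "odd_writhe D
      = (\<Sum>c\<in>{c \<in> chords D. monochromatic (endpoints D) c}. chord_sign c)"
    by (simp add: odd_writhe_def)
  then show ?thesis by (simp add: monochromatic_writhe_def sum.inter_filter)
qed

lemma monochromatic_writhe_cong:
  assumes "chords v = chords w"
    and "\<And>c. c \<in> chords w \<Longrightarrow> monochromatic v c \<longleftrightarrow> monochromatic w c"
  shows "monochromatic_writhe v = monochromatic_writhe w"
  using assms by (auto simp: monochromatic_writhe_def intro!: sum.cong)

section \<open>Effect of elementary changes on the colours\<close>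

lemma colour_swap:
  assumes "distinct (x @ [p, q] @ z)"
  shows "colour (x @ [q, p] @ z) m \<longleftrightarrow> colour (x @ [p, q] @ z) m \<noteq> (m \<in> {p, q})"
  using assms by (auto simp: colour_append colour_simps)

lemma colour_swap_strand:
  assumes "distinct (x @ strand k p q @ z)" "k \<noteq> 0"
  shows "colour (x @ strand (- k) p q @ z) m \<longleftrightarrow>
         colour (x @ strand k p q @ z) m \<noteq> (m \<in> {p, q})"
  using colour_swap[of x p q z m] colour_swap[of x q p z m] assms
  by (auto simp: strand_def split: if_splits)

lemma even_length_gauss_diagram:
  assumes "gauss_diagram w"
  shows "even (length (endpoints w))"
proof -
  have "set (endpoints w) = Over ` chords w \<union> Under ` chords w"
  proof (rule set_eqI)
    fix m
    show "m \<in> set (endpoints w) \<longleftrightarrow> m \<in> Over ` chords w \<union> Under ` chords w"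
      using assms by (cases m) (auto simp: chords_def gauss_diagram_def)
  qed
  moreover have "card (Over ` chords w \<union> Under ` chords w) = 2 * card (chords w)"
    by (subst card_Un_disjoint) (auto simp: card_image inj_on_def)
  ultimately have "length (endpoints w) = 2 * card (chords w)"
    using assms distinct_card[of "endpoints w"] by (simp add: gauss_diagram_def)
  then show ?thesis by simp
qed

lemma colour_rotate:
  assumes "distinct (x # w)" "even (length (x # w))" "m \<in> set (x # w)"
  shows "colour (w @ [x]) m \<longleftrightarrow> \<not> colour (x # w) m"
  using assms by (auto simp: colour_append colour_simps)

lemma monochromatic_writhe_rotate:
  assumes "gauss_diagram (x # w)"
  shows "monochromatic_writhe (endpoints (w @ [x])) = monochromatic_writhe (endpoints (x # w))"
proof (cases "x = Bar")
  case False
  then have E: "endpoints (x # w) = x # endpoints w" "endpoints (w @ [x]) = endpoints w @ [x]"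
    by (auto simp: endpoints_def)
  show ?thesis
  proof (rule monochromatic_writhe_cong)
    show "chords (endpoints (w @ [x])) = chords (endpoints (x # w))"
      unfolding chords_endpoints by (auto simp: chords_def)
    fix c assume "c \<in> chords (endpoints (x # w))"
    then have "Over c \<in> set (x # endpoints w)" "Under c \<in> set (x # endpoints w)"
      using assms unfolding chords_endpoints by (auto simp: gauss_diagram_def chords_def)
    moreover have "distinct (x # endpoints w)" "even (length (x # endpoints w))"
      using assms even_length_gauss_diagram[OF assms] E by (simp_all add: gauss_diagram_def)
    ultimately show "monochromatic (endpoints (w @ [x])) c
        \<longleftrightarrow> monochromatic (endpoints (x # w)) c"
      unfolding monochromatic_def E by (simp only: colour_rotate) blast
  qed
qed simp

lemma takeWhile_map_inj_on:
  assumes "inj_on g (insert m (set w))"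
  shows "takeWhile (\<lambda>x. x \<noteq> g m) (map g w) = map g (takeWhile (\<lambda>x. x \<noteq> m) w)"
  using assms by (induction w) (auto simp: inj_on_def)

lemma monochromatic_writhe_relabel:
  assumes "gauss_diagram w" "inj_on f (chords w)"
    and sign: "\<forall>c\<in>chords w. chord_sign (f c) = chord_sign c"
  shows "monochromatic_writhe (map (relabel f) (endpoints w))
       = monochromatic_writhe (endpoints w)"
proof -
  let ?E = "endpoints w"
  have inj: "inj_on (relabel f) (set ?E)"
  proof (rule inj_onI)
    fix m n assume "m \<in> set ?E" "n \<in> set ?E" "relabel f m = relabel f n"
    then show "m = n" using assms(2)
      by - (cases m; cases n; auto simp: chords_def inj_on_def)
  qed
  have colour: "colour (map (relabel f) ?E) (relabel f m) \<longleftrightarrow> colour ?E m"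
    if "m \<in> set ?E" for m
    using that inj by (simp add: colour_def takeWhile_map_inj_on insert_absorb)
  have mono: "monochromatic (map (relabel f) ?E) (f c) \<longleftrightarrow> monochromatic ?E c"
    if "c \<in> chords w" for c
  proof -
    have "Over c \<in> set ?E" "Under c \<in> set ?E"
      using that assms(1) by (auto simp: gauss_diagram_def chords_def)
    from this[THEN colour] show ?thesis by (simp add: monochromatic_def)
  qed
  have "chords (map (relabel f) v) = f ` chords v" for v
  proof (induction v)
    case (Cons m v)
    then show ?case by (cases m) auto
  qed simp
  then have "chords (map (relabel f) ?E) = f ` chords w" by simp
  then show ?thesis
    using assms(2) sign mono
    by (auto simp: monochromatic_writhe_def sum.reindex intro!: sum.cong)
qed

text \<open>The two forms of the first Reidemeister move, and, once the bar is erased, those of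
  \<open>T\<^sub>4\<close>. Neighbouring endpoints have different colours, so the chord contributes nothing.\<close>

lemma monochromatic_writhe_isolated_chord:
  assumes "gauss_diagram (p # q # w)" "{p, q} = {Over c, Under c}"
  shows "monochromatic_writhe (p # q # w) = monochromatic_writhe w"
proof -
  have c: "c \<notin> chords w" "chords (p # q # w) = insert c (chords w)"
    using assms by (auto simp: doubleton_eq_iff gauss_diagram_def chords_def)
  have "\<not> monochromatic (p # q # w) c"
    using assms by (auto simp: doubleton_eq_iff monochromatic_def colour_simps)
  moreover have "monochromatic (p # q # w) d \<longleftrightarrow> monochromatic w d" if "d \<in> chords w" for d
  proof -
    have "d \<noteq> c" using that c(1) by blast
    then show ?thesis
      using assms by (auto simp: doubleton_eq_iff monochromatic_def colour_simps)
  qed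
  ultimately show ?thesis
    using c by (auto simp: monochromatic_writhe_def intro!: sum.cong)
qed

text \<open>The two forms of the second Reidemeister move. Both pairs of endpoints consist of
  neighbours, so passing from one chord to the other switches two colours and keeps the parity.\<close>

lemma monochromatic_writhe_bigon:
  assumes gauss: "gauss_diagram (Over a # Over b # u @ p # q # v)"
    and pq: "{p, q} = {Under a, Under b}"
    and sign: "chord_sign b = - chord_sign a"
  shows "monochromatic_writhe (Over a # Over b # u @ p # q # v) = monochromatic_writhe (u @ v)"
proof -
  let ?w = "Over a # Over b # u @ p # q # v"
  have "a \<noteq> b" and new: "a \<notin> chords (u @ v)" "b \<notin> chords (u @ v)"
    and chords: "chords ?w = insert a (insert b (chords (u @ v)))"
    using gauss pq by (auto simp: doubleton_eq_iff gauss_diagram_def chords_def)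
  have under: "Under a \<notin> set u" "Under b \<notin> set u"
    using new by (auto simp: chords_def)
  have ab: "monochromatic ?w a \<longleftrightarrow> monochromatic ?w b"
    using \<open>a \<noteq> b\<close> pq under
    by (auto simp: doubleton_eq_iff monochromatic_def colour_append colour_simps)
  have rest: "monochromatic ?w c \<longleftrightarrow> monochromatic (u @ v) c"
    if "c \<in> chords (u @ v)" for c
  proof -
    have "c \<noteq> a" "c \<noteq> b" using that new by auto
    then show ?thesis using pq
      by (auto simp: doubleton_eq_iff monochromatic_def colour_append colour_simps)
  qed
  have "monochromatic_writhe ?w
      = (if monochromatic ?w a then chord_sign a else 0)
      + ((if monochromatic ?w b then chord_sign b else 0)
      + (\<Sum>c\<in>chords (u @ v). if monochromatic ?w c then chord_sign c else 0))"
    using \<open>a \<noteq> b\<close> new finite_chords[of "u @ v"]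
    unfolding monochromatic_writhe_def chords by (simp del: chords_simps)
  also have "\<dots> = (\<Sum>c\<in>chords (u @ v). if monochromatic ?w c then chord_sign c else 0)"
    using ab sign by simp
  also have "\<dots> = monochromatic_writhe (u @ v)"
    unfolding monochromatic_writhe_def using rest by (auto intro!: sum.cong)
  finally show ?thesis .
qed

text \<open>The two forms of the third Reidemeister move. The pairs \<open>p, p'\<close> and \<open>q, q'\<close> and
  \<open>r, r'\<close> are the endpoints on the three strands. By the last hypothesis every chord has both or
  none of its endpoints among these, hence both or none of its colours switched.\<close>

lemma monochromatic_writhe_triangle:
  assumes "distinct (strand i p p' @ u @ strand j q q' @ v @ strand k r r' @ w)"
    and nonzero: "i \<noteq> 0" "j \<noteq> 0" "k \<noteq> 0"
    and triangle: "\<forall>c. Over c \<in> {p, p', q, q', r, r'} \<longleftrightarrow> Under c \<in> {p, p', q, q', r, r'}"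
  shows "monochromatic_writhe
           (strand (- i) p p' @ u @ strand (- j) q q' @ v @ strand (- k) r r' @ w)
       = monochromatic_writhe (strand i p p' @ u @ strand j q q' @ v @ strand k r r' @ w)"
    (is "monochromatic_writhe ?w3 = monochromatic_writhe ?w0")
proof -
  have set_strand: "set (strand l x y) = {x, y}" for l x y
    by (auto simp: strand_def)
  have dist_strand: "distinct (strand l x y) \<longleftrightarrow> x \<noteq> y" for l x y
    by (auto simp: strand_def)
  let ?w1 = "strand (- i) p p' @ u @ strand j q q' @ v @ strand k r r' @ w"
  let ?w2 = "strand (- i) p p' @ u @ strand (- j) q q' @ v @ strand k r r' @ w"
  have dist1: "distinct ?w1" and dist2: "distinct ?w2"
    using assms(1) by (simp_all add: set_strand dist_strand)
  have colour: "colour ?w3 m \<longleftrightarrow> colour ?w0 m \<noteq> (m \<in> {p, p', q, q', r, r'})" for m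
  proof -
    have 1: "colour ?w1 m \<longleftrightarrow> colour ?w0 m \<noteq> (m \<in> {p, p'})"
      using colour_swap_strand[of "[]" i p p' "u @ strand j q q' @ v @ strand k r r' @ w" m]
        assms(1) nonzero by simp
    have 2: "colour ?w2 m \<longleftrightarrow> colour ?w1 m \<noteq> (m \<in> {q, q'})"
      using colour_swap_strand[of "strand (- i) p p' @ u" j q q' "v @ strand k r r' @ w" m]
        dist1 nonzero by simp
    have 3: "colour ?w3 m \<longleftrightarrow> colour ?w2 m \<noteq> (m \<in> {r, r'})"
      using colour_swap_strand[of "strand (- i) p p' @ u @ strand (- j) q q' @ v" k r r' w m]
        dist2 nonzero by simp
    have "{p, p'} \<inter> {q, q'} = {}" "{p, p'} \<inter> {r, r'} = {}" "{q, q'} \<inter> {r, r'} = {}"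
      using assms(1) by (auto simp: set_strand)
    with 1 2 3 show ?thesis by blast
  qed
  show ?thesis
  proof (rule monochromatic_writhe_cong)
    show "chords ?w3 = chords ?w0" by (auto simp: chords_def set_strand)
    show "monochromatic ?w3 c \<longleftrightarrow> monochromatic ?w0 c" for c
      unfolding monochromatic_def colour triangle[rule_format, of c] by blast
  qed
qed

text \<open>Without its bars, \<open>T\<^sub>3\<close> exchanges the colours of the two endpoints of one chord.\<close>

lemma monochromatic_writhe_reverse_chord:
  assumes "gauss_diagram (Over c # u @ Under c # v)"
  shows "monochromatic_writhe (Under c # u @ Over c # v)
       = monochromatic_writhe (Over c # u @ Under c # v)"
proof (rule monochromatic_writhe_cong)
  have "Over c \<notin> set u" "Under c \<notin> set u"
    using assms by (auto simp: gauss_diagram_def)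
  then show "monochromatic (Under c # u @ Over c # v) d
      \<longleftrightarrow> monochromatic (Over c # u @ Under c # v) d" for d
    by (cases "d = c") (auto simp: monochromatic_def colour_append colour_simps)
qed simp

text \<open>Only the two exchanged endpoints change colour, so the parity of at most two chords
  changes.\<close>

lemma monochromatic_writhe_swap_bound:
  assumes "distinct (p # q # w)"
    and pq: "(p = Over a \<and> q = Over b) \<or> (p = Under a \<and> q = Under b)"
  shows "\<bar>monochromatic_writhe (q # p # w) - monochromatic_writhe (p # q # w)\<bar> \<le> 2"
proof -
  let ?w = "p # q # w" and ?w' = "q # p # w"
  define change where "change c =
    (if monochromatic ?w' c then chord_sign c else 0)
      - (if monochromatic ?w c then chord_sign c else 0)" for c
  have chords: "chords ?w' = chords ?w" "{a, b} \<subseteq> chords ?w"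
    using pq by (auto simp: chords_def)
  have "change c = 0" if "c \<notin> {a, b}" for c
    using that pq by (auto simp: change_def monochromatic_def colour_simps)
  then have "(\<Sum>c\<in>chords ?w. change c) = (\<Sum>c\<in>{a, b}. change c)"
    using chords(2) finite_chords by (intro sum.mono_neutral_right) auto
  then have "monochromatic_writhe ?w' - monochromatic_writhe ?w = (\<Sum>c\<in>{a, b}. change c)"
    by (simp add: monochromatic_writhe_def chords(1) change_def flip: sum_subtractf)
  moreover have "\<bar>\<Sum>c\<in>{a, b}. change c\<bar> \<le> (\<Sum>c\<in>{a, b}. \<bar>change c\<bar>)"
    by (rule sum_abs)
  moreover have "(\<Sum>c\<in>{a, b}. \<bar>change c\<bar>) \<le> int (card {a, b}) * 1"
    by (rule sum_bounded_above) (simp add: change_def chord_sign_def)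
  moreover have "card {a, b} \<le> 2" by (simp add: card_insert_if)
  ultimately show ?thesis by linarith
qed

section \<open>Equivalence moves and forbidden moves\<close>

lemma chord_sign_nonzero [simp]: "chord_sign c \<noteq> 0"
  by (simp add: chord_sign_def)

lemma odd_writhe_equivalence_move:
  assumes "equivalence_move D D'" "gauss_diagram D" "gauss_diagram D'"
  shows "odd_writhe D = odd_writhe D'"
proof -
  have "monochromatic_writhe (endpoints D) = monochromatic_writhe (endpoints D')"
    using assms
  proof cases
    case (rotate x w)
    then show ?thesis using assms(2) monochromatic_writhe_rotate[of x w] by simp
  next
    case (relabel f)
    then show ?thesis using assms(2) monochromatic_writhe_relabel
      by (simp add: endpoints_map_relabel)
  next
    case (R1a c)
    then show ?thesis
      using assms(2) gauss_diagram_endpoints[of D]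
      by (simp add: monochromatic_writhe_isolated_chord[of _ _ _ c] del: gauss_diagram_endpoints)
  next
    case (R1b c)
    then show ?thesis
      using assms(2) gauss_diagram_endpoints[of D]
      by (simp add: monochromatic_writhe_isolated_chord[of _ _ _ c] insert_commute
          del: gauss_diagram_endpoints)
  next
    case (R2a b a u v)
    then show ?thesis
      using assms(2) gauss_diagram_endpoints[of D]
      by (simp add: monochromatic_writhe_bigon del: gauss_diagram_endpoints)
  next
    case (R2b b a u v)
    then show ?thesis
      using assms(2) gauss_diagram_endpoints[of D]
      by (simp add: monochromatic_writhe_bigon insert_commute del: gauss_diagram_endpoints)
  next
    case (R3a e a b u c v w)
    have "distinct (endpoints D)" using assms(2) by (simp add: gauss_diagram_def)
    then show ?thesis
      using R3a monochromatic_writhe_triangle[symmetric, of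
          "e * chord_sign a * chord_sign b" "Over a" "Over b" "endpoints u"
          "e * chord_sign a * chord_sign c" "Under a" "Over c" "endpoints v"
          "e * chord_sign b * chord_sign c" "Under b" "Under c" "endpoints w"]
      by (auto simp: disj_ac simp del: distinct_append)
  next
    case (R3b e a b u c v w)
    have "distinct (endpoints D)" using assms(2) by (simp add: gauss_diagram_def)
    then show ?thesis
      using R3b monochromatic_writhe_triangle[symmetric, of
          "e * chord_sign a * chord_sign b" "Over a" "Over b" "endpoints u"
          "e * chord_sign b * chord_sign c" "Under b" "Under c" "endpoints v"
          "e * chord_sign a * chord_sign c" "Under a" "Over c" "endpoints w"]
      by (auto simp: disj_ac simp del: distinct_append)
  next
    case T2
    then show ?thesis by simp
  next
    case (T3 c u v)
    then show ?thesis
      using assms(2) gauss_diagram_endpoints[of D]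
      by (simp add: monochromatic_writhe_reverse_chord del: gauss_diagram_endpoints)
  qed
  then show ?thesis using assms by (simp add: odd_writhe_eq_monochromatic_writhe)
qed

lemma odd_writhe_forbidden_move:
  assumes "forbidden_move D D'" "gauss_diagram D" "gauss_diagram D'"
  shows "\<bar>odd_writhe D' - odd_writhe D\<bar> \<le> 2"
proof -
  have dist: "distinct (endpoints D)" using assms(2) by (simp add: gauss_diagram_def)
  have gauss: "gauss_diagram (endpoints D)" using assms(2) by simp
  have "\<bar>monochromatic_writhe (endpoints D') - monochromatic_writhe (endpoints D)\<bar> \<le> 2"
    using assms(1)
  proof cases
    case (F1 a b w)
    then show ?thesis using dist monochromatic_writhe_swap_bound[of _ _ _ a b] by simp
  next
    case (F2 a b w)
    then show ?thesis using dist monochromatic_writhe_swap_bound[of _ _ _ a b] by simp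
  next
    case (F3 a b w)
    then show ?thesis using dist monochromatic_writhe_swap_bound[of _ _ _ a b] by simp
  next
    case (F4 a b w)
    then show ?thesis using dist monochromatic_writhe_swap_bound[of _ _ _ a b] by simp
  next
    case (T4a c w)
    then show ?thesis
      using gauss by (simp add: monochromatic_writhe_isolated_chord[of _ _ _ c]
          del: gauss_diagram_endpoints)
  next
    case (T4b c w)
    then show ?thesis
      using gauss by (simp add: monochromatic_writhe_isolated_chord[of _ _ _ c] insert_commute
          del: gauss_diagram_endpoints)
  qed
  then show ?thesis using assms by (simp add: odd_writhe_eq_monochromatic_writhe)
qed

section \<open>The bound on the forbidden number\<close>

lemma odd_writhe_twisted_equivalence:
  assumes "(D, D') \<in> twisted_equivalence"
  shows "odd_writhe D = odd_writhe D'"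
proof -
  have "(D, D') \<in> (between_diagrams equivalence_move)\<^sup>*"
    using assms by (simp add: twisted_equivalence_def)
  then show ?thesis
  proof induction
    case (step D' D'')
    then have "odd_writhe D' = odd_writhe D''"
      unfolding between_diagrams_def using odd_writhe_equivalence_move by force
    with step.IH show ?case by simp
  qed simp
qed

lemma odd_writhe_trivial:
  assumes "T \<in> \<Union> trivial_twisted_knots"
  shows "odd_writhe T = 0"
proof -
  have "(\<exists>D\<in>{[], [Bar]}. (D, T) \<in> twisted_equivalence)"
    using assms by (auto simp: trivial_twisted_knots_def)
  moreover have "odd_writhe [] = 0" "odd_writhe [Bar] = 0"
    by (simp_all add: odd_writhe_def)
  ultimately show ?thesis using odd_writhe_twisted_equivalence by force
qed

lemma odd_writhe_forbidden_sequence: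
  assumes "(D, D') \<in> (twisted_equivalence O between_diagrams forbidden_move) ^^ n"
  shows "\<bar>odd_writhe D' - odd_writhe D\<bar> \<le> 2 * int n"
  using assms
proof (induction n arbitrary: D')
  case (Suc n)
  then obtain B C where B: "(D, B) \<in> (twisted_equivalence O between_diagrams forbidden_move) ^^ n"
    and BC: "(B, C) \<in> twisted_equivalence" and CD': "(C, D') \<in> between_diagrams forbidden_move"
    by auto
  have "\<bar>odd_writhe D' - odd_writhe C\<bar> \<le> 2"
    using CD' odd_writhe_forbidden_move[of C D'] odd_writhe_forbidden_move[of D' C]
    by (auto simp: between_diagrams_def abs_minus_commute)
  with Suc.IH[OF B] odd_writhe_twisted_equivalence[OF BC] show ?case by simp
qed simp

lemma odd_writhe_trivialized_by:
  assumes "trivialized_by n D"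
  shows "\<bar>odd_writhe D\<bar> \<le> 2 * int n"
proof -
  obtain T D' where "T \<in> \<Union> trivial_twisted_knots"
    and "(D, D') \<in> (twisted_equivalence O between_diagrams forbidden_move) ^^ n"
    and "(D', T) \<in> twisted_equivalence"
    using assms by (auto simp: trivialized_by_def)
  then show ?thesis
    using odd_writhe_forbidden_sequence odd_writhe_twisted_equivalence odd_writhe_trivial
    by fastforce
qed

lemma odd_writhe_const_on_knot:
  assumes "K \<in> twisted_knots" "D \<in> K" "D' \<in> K"
  shows "odd_writhe D = odd_writhe D'"
proof -
  have "(D, D') \<in> twisted_equivalence"
    using assms quotient_eq_iff[OF equiv_twisted_equivalence]
    unfolding twisted_knots_def by blast
  then show ?thesis by (rule odd_writhe_twisted_equivalence)
qed

lemma odd_writhe_le_forbidden_number: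
  assumes "K \<in> twisted_knots" "D \<in> K"
  shows "ereal (real_of_int \<bar>odd_writhe D\<bar> / 2) \<le> ereal_of_enat (forbidden_number K)"
proof (cases "forbidden_number K")
  case (enat n)
  let ?S = "{enat n | n. \<exists>D\<in>K. trivialized_by n D}"
  have "?S \<noteq> {}"
    using enat by (auto simp: forbidden_number_def Inf_enat_def split: if_splits)
  \<comment> \<open>The extended naturals are well-ordered, so the infimum is attained.\<close>
  then have "forbidden_number K \<in> ?S"
    unfolding forbidden_number_def using wellorder_InfI[of _ ?S] by blast
  then obtain D' where "D' \<in> K" "trivialized_by n D'" using enat by auto
  then have "\<bar>odd_writhe D\<bar> \<le> 2 * int n"
    using odd_writhe_trivialized_by odd_writhe_const_on_knot[OF assms] by force
  then show ?thesis using enat by simp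
qed simp

theorem theorem5p4:
  fixes K :: "mark list set" and D :: "mark list"
  assumes "K \<in> twisted_knots" and "D \<in> K"
  shows "(even (bars D) \<longrightarrow>
           ereal_of_enat (forbidden_number K) \<ge> ereal (real_of_int (odd_writhe D) / 4)) \<and>
         (odd (bars D) \<longrightarrow>
           ereal_of_enat (forbidden_number K) \<ge> ereal (real_of_int (odd_writhe D) / 2))"
proof -
  have "ereal (real_of_int (odd_writhe D) / 4) \<le> ereal (real_of_int \<bar>odd_writhe D\<bar> / 2)"
    and "ereal (real_of_int (odd_writhe D) / 2) \<le> ereal (real_of_int \<bar>odd_writhe D\<bar> / 2)"
    by simp_all
  then show ?thesis
    using odd_writhe_le_forbidden_number[OF assms] order_trans by blast
qed

end
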